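(* Let $B$ be a left semi-brace such that $E$ is an ideal of $B$. Then the generalized socle $\operatorname{Zoc}(B)$ is an ideal of $B$.
   Context: A left semi-brace is a set $B$ with two operations $+$ and $\circ$ such that $(B,+)$ is a left cancellative semigroup (not necessarily commutative), $(B,\circ)$ is a group, and $a\circ(b+c)=a\circ b+a\circ(a^-+c)$ for all $a,b,c\in B$, where $a^-$ is the inverse of $a$ in $(B,\circ)$ and $\circ$ has higher precedence than $+$. The identity of $(B,\circ)$ is denoted $0$; it is an idempotent and a left identity of $(B,+)$. Let $E$ be the set of idempotents of $(B,+)$ and $G=B+0=\{b+0: b\in B\}$, which is a subgroup of $(B,+)$ (with identity $0$). For $a,b\in B$ put $\lambda_a(b)=a\circ(a^-+b)$ and $\rho_b(a)=(a^-+b)^-\circ b$. A subsemigroup $I$ of $(B,+)$ is an ideal of $B$ if: (i) $I$ is a normal subgroup of $(B,\circ)$; (ii) $I\cap G$ is a normal subgroup of $(G,+)$; (iii) $\rho_b(n)\in I$ for all $b\in B$, $n\in I\cap G$; (iv) $\lambda_g(e)\in I$ for all $g\in G$, $e\in I\cap E$. The socle of $B$ is $\operatorname{Soc}(B)=\{a\in B:\rho_a=\rho_0,\ \lambda_a=\lambda_0\}$; equivalently $\operatorname{Soc}(B)=\{a\in G: a+b=a\circ b \text{ and } -a+b+a=b+0 \text{ for all } b\in B\}$. It is known that $\operatorname{Soc}(B)$ is an ideal of $B$ contained in $G$. When $E$ is an ideal of $B$, the generalized socle of $B$ is $\operatorname{Zoc}(B)=\operatorname{Soc}(B)+E=\{a+e: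 a\in\operatorname{Soc}(B), e\in E\}$. *)

theory Defs
  imports "HOL-Algebra.Coset"
begin

text \<open>
  The multiplicative part of the record is the group \<open>(B,\<circ>)\<close>; its identity \<^term>\<open>one\<close>
  is the element written \<open>0\<close> in the literature. The field \<open>bplus\<close> is the (possibly
  noncommutative) semigroup operation \<open>+\<close>, written \<open>\<^bold>+\<close> and binding weaker than \<open>\<otimes>\<close>.
\<close>

record 'a semi_brace = "'a monoid" +
  bplus :: "'a \<Rightarrow> 'a \<Rightarrow> 'a" (infixl "\<^bold>+\<index>" 65)

locale left_semi_brace = group B for B (structure) +
  assumes bplus_closed:
      "\<lbrakk>a \<in> carrier B; b \<in> carrier B\<rbrakk> \<Longrightarrow> a \<^bold>+ b \<in> carrier B"
    and bplus_assoc: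
      "\<lbrakk>a \<in> carrier B; b \<in> carrier B; c \<in> carrier B\<rbrakk> \<Longrightarrow> (a \<^bold>+ b) \<^bold>+ c = a \<^bold>+ (b \<^bold>+ c)"
    and bplus_left_cancel:
      "\<lbrakk>a \<in> carrier B; b \<in> carrier B; c \<in> carrier B; a \<^bold>+ b = a \<^bold>+ c\<rbrakk> \<Longrightarrow> b = c"
    and mult_bplus:
      "\<lbrakk>a \<in> carrier B; b \<in> carrier B; c \<in> carrier B\<rbrakk>
        \<Longrightarrow> a \<otimes> (b \<^bold>+ c) = a \<otimes> b \<^bold>+ a \<otimes> (inv a \<^bold>+ c)"

definition idempotents :: "('a, 'm) semi_brace_scheme \<Rightarrow> 'a set"
  where "idempotents B = {e \<in> carrier B. e \<^bold>+\<^bsub>B\<^esub> e = e}"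

definition group_part :: "('a, 'm) semi_brace_scheme \<Rightarrow> 'a set"
  where "group_part B = {b \<^bold>+\<^bsub>B\<^esub> \<one>\<^bsub>B\<^esub> | b. b \<in> carrier B}"

definition additive_group :: "('a, 'm) semi_brace_scheme \<Rightarrow> 'a monoid"
  where "additive_group B =
    \<lparr>carrier = group_part B, monoid.mult = bplus B, one = \<one>\<^bsub>B\<^esub>\<rparr>"

definition lambda_map :: "('a, 'm) semi_brace_scheme \<Rightarrow> 'a \<Rightarrow> 'a \<Rightarrow> 'a"
  where "lambda_map B a b = a \<otimes>\<^bsub>B\<^esub> (inv\<^bsub>B\<^esub> a \<^bold>+\<^bsub>B\<^esub> b)"

text \<open>The subscript comes first: \<open>rho_map B b a\<close> is \<open>\<rho>\<^sub>b(a)\<close>.\<close>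

definition rho_map :: "('a, 'm) semi_brace_scheme \<Rightarrow> 'a \<Rightarrow> 'a \<Rightarrow> 'a"
  where "rho_map B b a = inv\<^bsub>B\<^esub> (inv\<^bsub>B\<^esub> a \<^bold>+\<^bsub>B\<^esub> b) \<otimes>\<^bsub>B\<^esub> b"

definition semi_brace_ideal :: "('a, 'm) semi_brace_scheme \<Rightarrow> 'a set \<Rightarrow> bool"
  where "semi_brace_ideal B I \<longleftrightarrow>
    I \<subseteq> carrier B \<and>
    (\<forall>x\<in>I. \<forall>y\<in>I. x \<^bold>+\<^bsub>B\<^esub> y \<in> I) \<and>
    I \<lhd> B \<and>
    (I \<inter> group_part B) \<lhd> additive_group B \<and>
    (\<forall>b\<in>carrier B. \<forall>n\<in>I \<inter> group_part B. rho_map B b n \<in> I) \<and>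
    (\<forall>g\<in>group_part B. \<forall>e\<in>I \<inter> idempotents B. lambda_map B g e \<in> I)"

text \<open>
  Elements outside the carrier are irrelevant, so equality of the maps \<open>\<rho>\<^sub>a = \<rho>\<^sub>0\<close> and
  \<open>\<lambda>\<^sub>a = \<lambda>\<^sub>0\<close> is equality on \<^term>\<open>carrier B\<close>.
\<close>

definition Soc :: "('a, 'm) semi_brace_scheme \<Rightarrow> 'a set"
  where "Soc B = {a \<in> carrier B.
    (\<forall>b\<in>carrier B. rho_map B a b = rho_map B \<one>\<^bsub>B\<^esub> b) \<and>
    (\<forall>b\<in>carrier B. lambda_map B a b = lambda_map B \<one>\<^bsub>B\<^esub> b)}"

definition Zoc :: "('a, 'm) semi_brace_scheme \<Rightarrow> 'a set"
  where "Zoc B = {a \<^bold>+\<^bsub>B\<^esub> e | a e. a \<in> Soc B \<and> e \<in> idempotents B}"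

context left_semi_brace
begin

lemma one_bplus: "c \<in> carrier B \<Longrightarrow> \<one> \<^bold>+ c = c"
  using mult_bplus[of \<one> \<one> c] bplus_left_cancel[of \<one> "\<one> \<^bold>+ c" c]
  by (simp add: bplus_closed)

text \<open>
  The predicate \<open>\<lhd>\<close> includes the requirement that the ambient structure be a group; for the
  additive structure on \<open>B + 0\<close> this always holds, so the ideal condition adds nothing extra.
\<close>

lemma group_additive_group: "group (additive_group B)"
proof -
  have G: "group_part B \<subseteq> carrier B"
    by (auto simp: group_part_def bplus_closed)
  have closed: "x \<^bold>+ y \<in> group_part B" if "x \<in> group_part B" "y \<in> group_part B" for x y
  proof -
    from that(2) obtain c where c: "c \<in> carrier B" "y = c \<^bold>+ \<one>"
      by (auto simp: group_part_def)
    then have "x \<^bold>+ y = (x \<^bold>+ c) \<^bold>+ \<one>" "x \<^bold>+ c \<in> carrier B"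
      using that(1) G by (auto simp: bplus_assoc bplus_closed)
    then show ?thesis
      by (auto simp: group_part_def)
  qed
  have one: "\<one> \<in> group_part B"
    using one_bplus[of \<one>] by (force simp: group_part_def)
  have right_one: "x \<^bold>+ \<one> = x" if "x \<in> group_part B" for x
    using that by (auto simp: group_part_def bplus_assoc one_bplus)
  have right_inv: "\<exists>y\<in>group_part B. x \<^bold>+ y = \<one>" if "x \<in> group_part B" for x
  proof -
    have x: "x \<in> carrier B"
      using that G by auto
    define z where "z = x \<otimes> (inv x \<^bold>+ inv x)"
    have z: "z \<in> carrier B"
      using x by (simp add: z_def bplus_closed)
    have "x \<^bold>+ z = \<one>"
      using mult_bplus[of x \<one> "inv x"] x by (simp add: z_def one_bplus)
    then have "x \<^bold>+ (z \<^bold>+ \<one>) = \<one>"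
      using x z bplus_assoc[of x z \<one>] by (simp add: one_bplus)
    then show ?thesis
      using z by (auto simp: group_part_def)
  qed
  have left_inv: "\<exists>y\<in>group_part B. y \<^bold>+ x = \<one>" if x: "x \<in> group_part B" for x
  proof -
    obtain y where y: "y \<in> group_part B" "x \<^bold>+ y = \<one>"
      using right_inv[OF x] by auto
    have "x \<^bold>+ (y \<^bold>+ x) = x \<^bold>+ \<one>"
      using bplus_assoc[of x y x, symmetric] x y G right_one[OF x] one_bplus[of x]
      by (simp add: subset_iff)
    then have "y \<^bold>+ x = \<one>"
      using bplus_left_cancel[of x "y \<^bold>+ x" \<one>] x y G closed by auto
    then show ?thesis
      using y by auto
  qed
  show ?thesis
    by (rule groupI)
      (use G one closed left_inv in \<open>auto simp: additive_group_def bplus_assoc one_bplus subset_iff\<close>)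
qed

end

end

theory Submission
  imports Defs "HOL-Algebra.SndIsomorphismGrp"
begin

text \<open>
  Write \<open>0\<close> for the identity of \<open>(B,\<circ>)\<close>, \<open>E\<close> for the set of idempotents and \<open>G = B + 0\<close>. The
  maps \<open>\<lambda>\<^sub>a\<close> form an action of \<open>(B,\<circ>)\<close> by endomorphisms of \<open>(B,+)\<close>, and \<open>a \<circ> b = a + \<lambda>\<^sub>a(b)\<close>.
  In these terms \<open>a\<close> lies in the socle iff \<open>\<lambda>\<^sub>a = id\<close> and \<open>b + a = a + b + 0\<close> for all \<open>b\<close>
  (lemma \<open>mem_Soc_iff\<close>). On the socle, therefore, \<open>a \<circ> b = a + b\<close>, and its elements are
  central in \<open>(G,+)\<close>.

  The socle is normal in \<open>(B,\<circ>)\<close>, because the conjugate \<open>b \<circ> a \<circ> b\<^sup>-\<close> of an element \<open>a\<close> of the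
  socle is \<open>\<lambda>\<^sub>b(a) + 0\<close> (lemmas \<open>conj_Soc_eq\<close> and \<open>Soc_normal\<close>). Since \<open>a + e = a \<circ> e\<close> for \<open>a\<close> in
  the socle, \<open>Zoc(B) = Soc(B) \<circ> E\<close> is a product of two normal subgroups of \<open>(B,\<circ>)\<close>, the
  second one being normal because \<open>E\<close> is an ideal. Moreover \<open>Zoc(B) \<inter> G = Soc(B)\<close>,
  because \<open>a + e \<in> G\<close> forces \<open>a + e = a + e + 0 = a\<close>. So \<open>Zoc(B) \<inter> G\<close> is a central subgroup
  of \<open>(G,+)\<close>, and for \<open>n\<close> in it \<open>\<rho>\<^sub>b(n) = b\<^sup>- \<circ> n \<circ> b\<close> is again in the socle. Finally,
  \<open>\<lambda>\<^sub>g(E) \<subseteq> E \<subseteq> Zoc(B)\<close>, as \<open>\<lambda>\<^sub>g\<close> is additive.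
\<close>

section \<open>The action by the maps \<open>\<lambda>\<^sub>a\<close>, and the idempotents\<close>

context left_semi_brace
begin

abbreviation lam :: "'a \<Rightarrow> 'a \<Rightarrow> 'a"
  where "lam \<equiv> lambda_map B"

lemma lam_closed [simp, intro]:
  "a \<in> carrier B \<Longrightarrow> b \<in> carrier B \<Longrightarrow> lam a b \<in> carrier B"
  by (simp add: lambda_map_def bplus_closed)

lemma mult_bplus_lam:
  "a \<in> carrier B \<Longrightarrow> b \<in> carrier B \<Longrightarrow> c \<in> carrier B \<Longrightarrow> a \<otimes> (b \<^bold>+ c) = a \<otimes> b \<^bold>+ lam a c"
  unfolding lambda_map_def by (rule mult_bplus)

lemma mult_eq_bplus_lam:
  "a \<in> carrier B \<Longrightarrow> b \<in> carrier B \<Longrightarrow> a \<otimes> b = a \<^bold>+ lam a b"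
  using mult_bplus_lam[of a \<one> b] by (simp add: one_bplus)

lemma lam_bplus:
  assumes "a \<in> carrier B" "b \<in> carrier B" "c \<in> carrier B"
  shows "lam a (b \<^bold>+ c) = lam a b \<^bold>+ lam a c"
proof -
  have "lam a (b \<^bold>+ c) = a \<otimes> ((inv a \<^bold>+ b) \<^bold>+ c)"
    using assms by (simp add: lambda_map_def bplus_assoc)
  also have "\<dots> = a \<otimes> (inv a \<^bold>+ b) \<^bold>+ lam a c"
    using assms by (intro mult_bplus_lam) (auto simp: bplus_closed)
  finally show ?thesis
    by (simp add: lambda_map_def)
qed

lemma lam_one [simp]: "b \<in> carrier B \<Longrightarrow> lam \<one> b = b"
  by (simp add: lambda_map_def one_bplus bplus_closed)

lemma lam_mult:
  assumes "a \<in> carrier B" "b \<in> carrier B" "c \<in> carrier B"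
  shows "lam (a \<otimes> b) c = lam a (lam b c)"
proof -
  have "b \<otimes> (inv (a \<otimes> b) \<^bold>+ c) = b \<otimes> inv (a \<otimes> b) \<^bold>+ lam b c"
    using assms by (intro mult_bplus_lam) auto
  also have "b \<otimes> inv (a \<otimes> b) = inv a"
    using assms by (simp add: inv_mult_group m_assoc[symmetric])
  finally have "a \<otimes> (b \<otimes> (inv (a \<otimes> b) \<^bold>+ c)) = lam a (lam b c)"
    by (simp add: lambda_map_def)
  then show ?thesis
    using assms by (simp add: lambda_map_def[of B "a \<otimes> b"] m_assoc bplus_closed)
qed

lemma lam_inv_right:
  "a \<in> carrier B \<Longrightarrow> b \<in> carrier B \<Longrightarrow> lam a (lam (inv a) b) = b"
  using lam_mult[of a "inv a" b] by simp

lemma lam_inv_left: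
  "a \<in> carrier B \<Longrightarrow> b \<in> carrier B \<Longrightarrow> lam (inv a) (lam a b) = b"
  using lam_mult[of "inv a" a b] by simp

lemma rho_eq:
  assumes "a \<in> carrier B" "b \<in> carrier B"
  shows "rho_map B b a = inv (lam a b) \<otimes> a \<otimes> b"
proof -
  have "inv (lam a b) \<otimes> a = inv (inv a \<^bold>+ b)"
    using assms by (simp add: lambda_map_def inv_mult_group bplus_closed m_assoc)
  then show ?thesis
    by (simp add: rho_map_def)
qed

lemma idempotents_closed: "e \<in> idempotents B \<Longrightarrow> e \<in> carrier B"
  by (simp add: idempotents_def)

lemma idempotent_bplus:
  assumes e: "e \<in> idempotents B" and c: "c \<in> carrier B"
  shows "e \<^bold>+ c = c"
proof (rule bplus_left_cancel[of e])
  show "e \<^bold>+ (e \<^bold>+ c) = e \<^bold>+ c"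
    using e c bplus_assoc[of e e c] by (simp add: idempotents_def)
qed (use e c in \<open>auto simp: idempotents_def bplus_closed\<close>)

lemma one_idempotent: "\<one> \<in> idempotents B"
  by (simp add: idempotents_def one_bplus)

lemma lam_idempotent:
  assumes "a \<in> carrier B" "e \<in> idempotents B"
  shows "lam a e \<in> idempotents B"
  using assms lam_bplus[of a e e] by (auto simp: idempotents_def)

lemma group_part_closed: "g \<in> group_part B \<Longrightarrow> g \<in> carrier B"
  by (auto simp: group_part_def bplus_closed)

lemma mem_group_part_iff: "g \<in> group_part B \<longleftrightarrow> g \<in> carrier B \<and> g \<^bold>+ \<one> = g"
proof
  assume "g \<in> group_part B"
  then show "g \<in> carrier B \<and> g \<^bold>+ \<one> = g"
    by (auto simp: group_part_def bplus_closed bplus_assoc one_bplus)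
next
  assume "g \<in> carrier B \<and> g \<^bold>+ \<one> = g"
  then show "g \<in> group_part B"
    unfolding group_part_def by force
qed

section \<open>The socle\<close>

text \<open>
  The condition on \<open>\<rho>\<^sub>a\<close> reads \<open>(b\<^sup>- + a)\<^sup>- \<circ> a = (b\<^sup>- + 0)\<^sup>-\<close>, that is, \<open>c + a = a \<circ> (c + 0)\<close> with
  \<open>c = b\<^sup>-\<close>, and the right-hand side is \<open>a + c + 0\<close> as soon as \<open>\<lambda>\<^sub>a = id\<close>.
\<close>

lemma mem_Soc_iff:
  "a \<in> Soc B \<longleftrightarrow> a \<in> carrier B \<and> (\<forall>b\<in>carrier B. lam a b = b)
     \<and> (\<forall>b\<in>carrier B. b \<^bold>+ a = a \<^bold>+ b \<^bold>+ \<one>)"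
proof -
  have rho: "rho_map B a (inv c) = rho_map B \<one> (inv c) \<longleftrightarrow> c \<^bold>+ a = a \<^bold>+ c \<^bold>+ \<one>"
    if a: "a \<in> carrier B" and lam: "\<forall>b\<in>carrier B. lam a b = b" and c: "c \<in> carrier B" for c
  proof -
    have "rho_map B a (inv c) = rho_map B \<one> (inv c) \<longleftrightarrow> inv (c \<^bold>+ a) \<otimes> a = inv (c \<^bold>+ \<one>)"
      using a c by (simp add: rho_map_def bplus_closed)
    also have "\<dots> \<longleftrightarrow> a = (c \<^bold>+ a) \<otimes> inv (c \<^bold>+ \<one>)"
      using a c inv_solve_left[of "inv (c \<^bold>+ \<one>)" "c \<^bold>+ a" a] by (auto simp: bplus_closed)
    also have "\<dots> \<longleftrightarrow> c \<^bold>+ a = a \<otimes> (c \<^bold>+ \<one>)"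
      using a c inv_solve_right[of a "c \<^bold>+ a" "c \<^bold>+ \<one>"] by (simp add: bplus_closed)
    also have "a \<otimes> (c \<^bold>+ \<one>) = a \<^bold>+ c \<^bold>+ \<one>"
      using a c lam by (simp add: mult_eq_bplus_lam bplus_closed bplus_assoc)
    finally show ?thesis .
  qed
  have "(\<forall>b\<in>carrier B. rho_map B a b = rho_map B \<one> b)
      \<longleftrightarrow> (\<forall>c\<in>carrier B. rho_map B a (inv c) = rho_map B \<one> (inv c))"
    by (metis inv_closed inv_inv)
  with rho show ?thesis
    unfolding Soc_def by auto
qed

lemma Soc_closed: "a \<in> Soc B \<Longrightarrow> a \<in> carrier B"
  and Soc_lam: "a \<in> Soc B \<Longrightarrow> b \<in> carrier B \<Longrightarrow> lam a b = b"
  and Soc_comm: "a \<in> Soc B \<Longrightarrow> b \<in> carrier B \<Longrightarrow> b \<^bold>+ a = a \<^bold>+ b \<^bold>+ \<one>"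
  unfolding mem_Soc_iff by blast+

lemma Soc_mult: "a \<in> Soc B \<Longrightarrow> b \<in> carrier B \<Longrightarrow> a \<otimes> b = a \<^bold>+ b"
  by (simp add: mult_eq_bplus_lam Soc_lam Soc_closed)

lemma Soc_bplus_one: "a \<in> Soc B \<Longrightarrow> a \<^bold>+ \<one> = a"
  using Soc_mult[of a \<one>, symmetric] by (simp add: Soc_closed)

lemma Soc_subset_group_part: "Soc B \<subseteq> group_part B"
  by (auto simp: mem_group_part_iff Soc_bplus_one Soc_closed)

lemma one_mem_Soc: "\<one> \<in> Soc B"
  by (simp add: mem_Soc_iff one_bplus)

lemma Soc_bplus_closed:
  assumes a: "a \<in> Soc B" and b: "b \<in> Soc B"
  shows "a \<^bold>+ b \<in> Soc B"
  unfolding mem_Soc_iff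
proof (intro conjI ballI)
  note [simp] = Soc_closed[OF a] Soc_closed[OF b]
  show "a \<^bold>+ b \<in> carrier B"
    by (simp add: bplus_closed)
  fix x assume x [simp]: "x \<in> carrier B"
  show "lam (a \<^bold>+ b) x = x"
    using a b lam_mult[of a b x] by (simp add: Soc_mult Soc_lam)
  have "x \<^bold>+ (a \<^bold>+ b) = (a \<^bold>+ x \<^bold>+ \<one>) \<^bold>+ b"
    by (simp add: bplus_assoc[symmetric] Soc_comm[OF a])
  also have "\<dots> = a \<^bold>+ (x \<^bold>+ b)"
    by (simp add: bplus_assoc bplus_closed one_bplus)
  also have "\<dots> = a \<^bold>+ b \<^bold>+ x \<^bold>+ \<one>"
    by (simp add: Soc_comm[OF b x] bplus_assoc bplus_closed)
  finally show "x \<^bold>+ (a \<^bold>+ b) = a \<^bold>+ b \<^bold>+ x \<^bold>+ \<one>" .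
qed

lemma Soc_inv_closed:
  assumes a: "a \<in> Soc B"
  shows "inv a \<in> Soc B"
  unfolding mem_Soc_iff
proof (intro conjI ballI)
  note [simp] = Soc_closed[OF a]
  show "inv a \<in> carrier B"
    by simp
  fix x assume x [simp]: "x \<in> carrier B"
  show "lam (inv a) x = x"
    using lam_inv_left[of a x] Soc_lam[OF a, of x] by simp
  have a_inv: "a \<^bold>+ inv a = \<one>"
    using Soc_mult[OF a, of "inv a"] by simp
  have "a \<^bold>+ (x \<^bold>+ inv a) = (a \<^bold>+ x \<^bold>+ \<one>) \<^bold>+ inv a"
    by (simp add: bplus_assoc bplus_closed one_bplus)
  also have "\<dots> = x \<^bold>+ (a \<^bold>+ inv a)"
    by (simp add: Soc_comm[OF a x, symmetric]) (simp add: bplus_assoc)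
  also have "\<dots> = (a \<^bold>+ inv a) \<^bold>+ (x \<^bold>+ \<one>)"
    by (simp add: a_inv one_bplus bplus_closed)
  also have "\<dots> = a \<^bold>+ (inv a \<^bold>+ x \<^bold>+ \<one>)"
    by (simp add: bplus_assoc bplus_closed)
  finally show "x \<^bold>+ inv a = inv a \<^bold>+ x \<^bold>+ \<one>"
    by (rule bplus_left_cancel[rotated -1]) (simp_all add: bplus_closed)
qed

text \<open>
  This is the defining commutation rule of the socle, transported along \<open>\<lambda>\<^sub>b\<close>.
\<close>

lemma bplus_lam_Soc:
  assumes a: "a \<in> Soc B" and b: "b \<in> carrier B" and x: "x \<in> carrier B"
  shows "x \<^bold>+ lam b a = lam b a \<^bold>+ x \<^bold>+ lam b \<one>"
proof -
  define y where "y = lam (inv b) x"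
  have y: "y \<in> carrier B" "lam b y = x"
    using b x by (auto simp: y_def lam_inv_right)
  have "lam b (y \<^bold>+ a) = lam b (a \<^bold>+ y \<^bold>+ \<one>)"
    using Soc_comm[OF a y(1)] by simp
  then show ?thesis
    using y b Soc_closed[OF a] by (simp add: lam_bplus bplus_closed)
qed

lemma conj_Soc_eq:
  assumes a: "a \<in> Soc B" and b: "b \<in> carrier B"
  shows "b \<otimes> a \<otimes> inv b = lam b a \<^bold>+ \<one>"
proof -
  note [simp] = b Soc_closed[OF a]
  have "b \<otimes> a \<otimes> inv b = b \<otimes> a \<^bold>+ lam b (inv b)"
    by (simp add: mult_eq_bplus_lam[of "b \<otimes> a"] lam_mult Soc_lam[OF a])
  also have "\<dots> = lam b a \<^bold>+ b \<^bold>+ lam b \<one> \<^bold>+ lam b (inv b)"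
    by (simp add: mult_eq_bplus_lam[of b a] bplus_lam_Soc[OF a])
  also have "\<dots> = lam b a \<^bold>+ (b \<^bold>+ (lam b \<one> \<^bold>+ lam b (inv b)))"
    by (simp add: bplus_assoc bplus_closed)
  also have "lam b \<one> \<^bold>+ lam b (inv b) = lam b (inv b)"
    by (simp add: idempotent_bplus lam_idempotent one_idempotent)
  also have "b \<^bold>+ lam b (inv b) = \<one>"
    using mult_eq_bplus_lam[of b "inv b"] by simp
  finally show ?thesis .
qed

lemma conj_Soc_closed:
  assumes a: "a \<in> Soc B" and b: "b \<in> carrier B"
  shows "b \<otimes> a \<otimes> inv b \<in> Soc B"
  unfolding mem_Soc_iff
proof (intro conjI ballI)
  note [simp] = b Soc_closed[OF a]
  show "b \<otimes> a \<otimes> inv b \<in> carrier B"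
    by simp
  fix x assume x [simp]: "x \<in> carrier B"
  show "lam (b \<otimes> a \<otimes> inv b) x = x"
    by (simp add: lam_mult Soc_lam[OF a] lam_inv_right)
  have "x \<^bold>+ (lam b a \<^bold>+ \<one>) = (lam b a \<^bold>+ x \<^bold>+ lam b \<one>) \<^bold>+ \<one>"
    by (simp add: bplus_assoc[symmetric] bplus_lam_Soc[OF a])
  also have "\<dots> = lam b a \<^bold>+ (x \<^bold>+ (lam b \<one> \<^bold>+ \<one>))"
    by (simp add: bplus_assoc bplus_closed)
  also have "lam b \<one> \<^bold>+ \<one> = \<one>"
    by (simp add: idempotent_bplus lam_idempotent one_idempotent)
  also have "lam b a \<^bold>+ (x \<^bold>+ \<one>) = lam b a \<^bold>+ \<one> \<^bold>+ x \<^bold>+ \<one>"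
    by (simp add: bplus_assoc bplus_closed one_bplus)
  finally show "x \<^bold>+ b \<otimes> a \<otimes> inv b = b \<otimes> a \<otimes> inv b \<^bold>+ x \<^bold>+ \<one>"
    by (simp add: conj_Soc_eq[OF a])
qed

lemma Soc_normal: "Soc B \<lhd> B"
proof (rule normal_invI)
  show "subgroup (Soc B) B"
  proof (rule subgroupI)
    show "Soc B \<noteq> {}"
      using one_mem_Soc by auto
  qed (auto simp: Soc_closed Soc_inv_closed Soc_mult Soc_bplus_closed)
qed (rule conj_Soc_closed)

lemma rho_Soc:
  assumes n: "n \<in> Soc B" and b: "b \<in> carrier B"
  shows "rho_map B b n \<in> Soc B"
  using n b conj_Soc_closed[OF n, of "inv b"] by (simp add: rho_eq Soc_closed Soc_lam)

lemma Soc_normal_additive: "Soc B \<lhd> additive_group B"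
proof -
  interpret A: group "additive_group B"
    by (rule group_additive_group)
  have carrier [simp]: "carrier (additive_group B) = group_part B"
    and mult [simp]: "\<And>x y. x \<otimes>\<^bsub>additive_group B\<^esub> y = x \<^bold>+ y"
    and one [simp]: "\<one>\<^bsub>additive_group B\<^esub> = \<one>"
    by (simp_all add: additive_group_def)
  have mem: "a \<in> group_part B" if "a \<in> Soc B" for a
    using that Soc_subset_group_part by auto
  \<comment> \<open>On the socle the additive inverse is the multiplicative one.\<close>
  have inv_eq: "inv\<^bsub>additive_group B\<^esub> a = inv a" if a: "a \<in> Soc B" for a
  proof (rule A.inv_equality)
    show "inv a \<otimes>\<^bsub>additive_group B\<^esub> a = \<one>\<^bsub>additive_group B\<^esub>"
      using Soc_mult[OF Soc_inv_closed[OF a], of a] a by (simp add: Soc_closed)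
  qed (use a in \<open>auto simp: mem Soc_inv_closed\<close>)
  show ?thesis
  proof (rule A.normal_invI)
    show "subgroup (Soc B) (additive_group B)"
    proof (rule A.subgroupI)
      show "Soc B \<noteq> {}"
        using one_mem_Soc by auto
    qed (auto simp: mem inv_eq Soc_inv_closed Soc_bplus_closed)
  next
    fix g a assume "g \<in> carrier (additive_group B)" and a: "a \<in> Soc B"
    then have g: "g \<in> group_part B"
      by simp
    have "g \<^bold>+ a = a \<^bold>+ g"
      using Soc_comm[OF a group_part_closed[OF g]] g Soc_closed[OF a]
      by (simp add: bplus_assoc mem_group_part_iff)
    then have "g \<otimes>\<^bsub>additive_group B\<^esub> a \<otimes>\<^bsub>additive_group B\<^esub> inv\<^bsub>additive_group B\<^esub> g = a"
      using A.inv_solve_right'[of a a g] g mem[OF a] A.m_closed[of a g] A.m_assoc[of a g]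
        A.r_inv[of g] A.r_one[of a] A.inv_closed[of g]
      by simp
    with a show "g \<otimes>\<^bsub>additive_group B\<^esub> a \<otimes>\<^bsub>additive_group B\<^esub> inv\<^bsub>additive_group B\<^esub> g \<in> Soc B"
      by simp
  qed
qed

section \<open>The generalized socle\<close>

lemma Zoc_eq_set_mult: "Zoc B = Soc B <#> idempotents B"
  unfolding Zoc_def set_mult_def using idempotents_closed Soc_mult by fastforce

lemma idempotents_subset_Zoc: "idempotents B \<subseteq> Zoc B"
proof
  fix e assume e: "e \<in> idempotents B"
  then have "e = \<one> \<^bold>+ e"
    by (simp add: one_bplus idempotents_closed)
  with e one_mem_Soc show "e \<in> Zoc B"
    unfolding Zoc_def by blast
qed

lemma Zoc_inter_group_part: "Zoc B \<inter> group_part B = Soc B"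
proof
  show "Zoc B \<inter> group_part B \<subseteq> Soc B"
  proof
    fix x assume "x \<in> Zoc B \<inter> group_part B"
    then obtain a e where ae: "a \<in> Soc B" "e \<in> idempotents B" "x = a \<^bold>+ e" "x \<^bold>+ \<one> = x"
      by (auto simp: Zoc_def mem_group_part_iff)
    then have "x = a"
      by (simp add: bplus_assoc Soc_closed idempotents_closed idempotent_bplus Soc_bplus_one)
    with ae show "x \<in> Soc B"
      by simp
  qed
  have "a \<in> Zoc B" if "a \<in> Soc B" for a
    unfolding Zoc_def using that Soc_bplus_one[OF that, symmetric] one_idempotent by blast
  then show "Soc B \<subseteq> Zoc B \<inter> group_part B"
    using Soc_subset_group_part by auto
qed

lemma Zoc_bplus_closed:
  assumes "x \<in> Zoc B" "y \<in> Zoc B"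
  shows "x \<^bold>+ y \<in> Zoc B"
proof -
  obtain a e a' e' where ae: "a \<in> Soc B" "e \<in> idempotents B" "x = a \<^bold>+ e"
      "a' \<in> Soc B" "e' \<in> idempotents B" "y = a' \<^bold>+ e'"
    using assms by (auto simp: Zoc_def)
  then have "x \<^bold>+ y = (a \<^bold>+ a') \<^bold>+ e'"
    by (simp add: bplus_assoc bplus_closed Soc_closed idempotents_closed idempotent_bplus)
  then show ?thesis
    unfolding Zoc_def using ae Soc_bplus_closed by blast
qed

lemma semi_brace_ideal_Zoc:
  assumes E: "idempotents B \<lhd> B"
  shows "semi_brace_ideal B (Zoc B)"
  unfolding semi_brace_ideal_def Zoc_inter_group_part
proof (intro conjI ballI)
  show "Zoc B \<lhd> B"
    unfolding Zoc_eq_set_mult by (rule normal_subgroup_set_mult_closed[OF Soc_normal E])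
  show "Zoc B \<subseteq> carrier B"
    by (auto simp: Zoc_def bplus_closed Soc_closed idempotents_closed)
  show "Soc B \<lhd> additive_group B"
    by (rule Soc_normal_additive)
  show "x \<^bold>+ y \<in> Zoc B" if "x \<in> Zoc B" "y \<in> Zoc B" for x y
    using that by (rule Zoc_bplus_closed)
  show "rho_map B b n \<in> Zoc B" if "b \<in> carrier B" "n \<in> Soc B" for b n
    using rho_Soc[OF that(2,1)] Zoc_inter_group_part by auto
  show "lam g e \<in> Zoc B" if "g \<in> group_part B" "e \<in> Zoc B \<inter> idempotents B" for g e
    using that lam_idempotent[of g e] group_part_closed idempotents_subset_Zoc by auto
qed

end

theorem proposition22:
  assumes "left_semi_brace B"
    and "semi_brace_ideal B (idempotents B)"
  shows "semi_brace_ideal B (Zoc B)"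
proof -
  interpret left_semi_brace B
    by (rule assms(1))
  show ?thesis
    using assms(2) semi_brace_ideal_Zoc by (simp add: semi_brace_ideal_def)
qed

end
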